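(* If the price vectors are collinear, i.e. $p_j=\lambda_jp_1$ for some $\lambda_j>0$, $j=1,\dots,\ell$, then $\mathcal V(G)=0$ for any $G\in\Omega(\bar q)$.
   Context: Notation: $\mathbb{R}_+^k$ and $\mathbb{R}_{++}^k$ are the vectors in $\mathbb{R}^k$ with all coordinates $\ge 0$, respectively $>0$. Economy. $X\subset\mathbb{R}^m$ is compact and convex. There are $k$ goods, good $i$ being supplied at a point $x_i\in X$, and $\ell$ consumers, consumer $j$ being located at $y_j\in X$ (all these points distinct). Consumer $j$ has a utility function $u_j:\mathbb{R}_+^k\to\mathbb{R}$ that is continuous, concave and increasing ($u_j(q')>u_j(q)$ whenever $q'_i>q_i$ for all $i$), a wealth $w_j>0$ and a price vector $p_j=(p_{1j},\dots,p_{kj})\in\mathbb{R}_{++}^k$. Fix for each $j$ a maximizer $\bar q_j=(\bar q_{1j},\dots,\bar q_{kj})$ of $u_j(q_j)$ over $\{q_j\in\mathbb{R}_+^k: p_j\cdot q_j\le w_j\}$, and let $\bar q=(\bar q_{ij})_{k\times\ell}$, normalized so that $\sum_{i,j}\bar q_{ij}=1$. Put $m_i=\sum_j\bar q_{ij}$, $n_j=\sum_i\bar q_{ij}$ (all positive), $\mathbf a=\sum_i m_i\delta_{x_i}$, $\mathbf b=\sum_j n_j\delta_{y_j}$. $\mathcal P(X\times X)$ denotes probability measures $q=\sum_{i,j}q_{ij}\delta_{(x_i,y_j)}$, identified with nonnegative $k\times\ell$ matrices of total sum 1; $q_j=(q_{1j},\dots,q_{kj})$ is the $j$-th column. Transport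 paths. A transport path $G$ from $\mathbf a$ to $\mathbf b$ is a finite weighted directed graph with vertex set $V(G)\subset X$ containing all $x_i,y_j$, directed edges $e\in E(G)$ which are line segments from $e^-$ to $e^+$, and weights $w(e)>0$, such that for every vertex $v$, $\sum_{e^-=v}w(e)=\sum_{e^+=v}w(e)+c_v$, where $c_v=m_i$ if $v=x_i$, $c_v=-n_j$ if $v=y_j$, and $c_v=0$ otherwise. It is assumed that for each $(i,j)$ there is at most one directed curve $g_{ij}$ from $x_i$ to $y_j$ in $G$, i.e. at most one list of distinct vertices starting at $x_i$ and ending at $y_j$ whose consecutive members are joined by directed edges of $G$; $e\subseteq g_{ij}$ means that the edge $e$ lies on this curve. A matrix $q\in\mathcal P(X\times X)$ is compatible with $G$ if $q_{ij}=0$ whenever $g_{ij}$ does not exist and $\sum_{(i,j):e\subseteq g_{ij}}q_{ij}=w(e)$ for every $e\in E(G)$. $\Omega(\bar q)$ is the set of transport paths $G$ from $\mathbf a$ to $\mathbf b$ with which $\bar q$ is compatible. Exchange value. $S(q)=\sum_{j=1}^\ell\min\{p_j\cdot t_j: t_j\in\mathbb{R}_+^k,\ u_j(t_j)\ge u_j(q_j)\}$. For $G\in\Omega(\bar q)$, $\mathcal F_G$ is the set of $q\in\mathcal P(X\times X)$ compatible with $G$ with $u_j(q_j)\ge u_j(\bar q_j)$ for all $j$, and $\mathcal V(G)=\max_{q\in\mathcal F_G}S(q)-S(\bar q)$. *)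

theory Defs
  imports
    "HOL-Analysis.Analysis"
    "Graph_Theory.Pair_Digraph"
    "Graph_Theory.Vertex_Walk"
begin

text \<open>
  Goods are indexed by a finite type \<open>'k\<close>, consumers by a finite type \<open>'l\<close>. A \<open>k \<times> l\<close> matrix
  has type \<open>real^'l^'k\<close>, so \<open>q $ i $ j\<close> is the entry in row \<open>i\<close> and column \<open>j\<close>, and
  \<open>column j q\<close> is the bundle of consumer \<open>j\<close>.
\<close>

definition nonneg_orthant :: "(real^'k) set" where
  "nonneg_orthant = {t. \<forall>i. 0 \<le> t $ i}"

definition budget_set :: "real^'k \<Rightarrow> real \<Rightarrow> (real^'k::finite) set" where
  "budget_set p w = {t \<in> nonneg_orthant. p \<bullet> t \<le> w}"

text \<open>
  The matrices representing probability measures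
  \<open>\<Sum>\<^sub>i\<^sub>,\<^sub>j q\<^sub>i\<^sub>j \<delta>\<^bsub>(x\<^sub>i, y\<^sub>j)\<^esub>\<close>, together with the masses of their two marginals at
  \<open>x\<^sub>i\<close> and at \<open>y\<^sub>j\<close>.
\<close>

definition prob_matrices :: "(real^'l::finite^'k::finite) set" where
  "prob_matrices = {q. (\<forall>i j. 0 \<le> q $ i $ j) \<and> (\<Sum>i\<in>UNIV. \<Sum>j\<in>UNIV. q $ i $ j) = 1}"

definition source_mass :: "real^'l::finite^'k \<Rightarrow> 'k \<Rightarrow> real" where
  "source_mass q i = (\<Sum>j\<in>UNIV. q $ i $ j)"

definition target_mass :: "real^'l^'k::finite \<Rightarrow> 'l \<Rightarrow> real" where
  "target_mass q j = (\<Sum>i\<in>UNIV. q $ i $ j)"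

locale exchange_economy =
  fixes X :: "(real^'m) set"
    and x :: "'k::finite \<Rightarrow> real^'m"
    and y :: "'l::finite \<Rightarrow> real^'m"
    and u :: "'l \<Rightarrow> real^'k \<Rightarrow> real"
    and p :: "'l \<Rightarrow> real^'k"
    and w :: "'l \<Rightarrow> real"
    and qbar :: "real^'l^'k"
  assumes compact_X: "compact X"
    and convex_X: "convex X"
    and x_in_X: "\<And>i. x i \<in> X"
    and y_in_X: "\<And>j. y j \<in> X"
    and inj_x: "inj x"
    and inj_y: "inj y"
    and x_neq_y: "\<And>i j. x i \<noteq> y j"
    and u_continuous: "\<And>j. continuous_on nonneg_orthant (u j)"
    and u_concave: "\<And>j. concave_on nonneg_orthant (u j)"
    and u_increasing: "\<And>j t t'. t \<in> nonneg_orthant \<Longrightarrow> t' \<in> nonneg_orthant \<Longrightarrow>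
          (\<forall>i. t $ i < t' $ i) \<Longrightarrow> u j t < u j t'"
    and wealth_pos: "\<And>j. 0 < w j"
    and price_pos: "\<And>i j. 0 < p j $ i"
    and qbar_optimal: "\<And>j. is_arg_max (u j) (\<lambda>t. t \<in> budget_set (p j) (w j)) (column j qbar)"
    and qbar_normalized: "(\<Sum>i\<in>UNIV. \<Sum>j\<in>UNIV. qbar $ i $ j) = 1"
    and source_mass_pos: "\<And>i. 0 < source_mass qbar i"
    and target_mass_pos: "\<And>j. 0 < target_mass qbar j"

text \<open>
  A weighted directed graph is a digraph \<open>G\<close> whose edges are pairs \<open>(e\<^sup>-, e\<^sup>+)\<close> of vertices (an edge is
  the line segment between its end points, hence determined by them), together with a weight
  function, of which only the values on the edges of \<open>G\<close> matter.
\<close>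

type_synonym 'v weighted_digraph = "'v pair_pre_digraph \<times> ('v \<times> 'v \<Rightarrow> real)"

definition directed_curve :: "'v pair_pre_digraph \<Rightarrow> 'v \<Rightarrow> 'v \<Rightarrow> 'v list \<Rightarrow> bool" where
  "directed_curve G a b c \<longleftrightarrow> vpath c (with_proj G) \<and> hd c = a \<and> last c = b"

text \<open>
  The two sums in the balance equation with \<open>m\<close> and \<open>n\<close> are the masses that
  \<open>\<Sum>\<^sub>i m\<^sub>i \<delta>\<^bsub>x\<^sub>i\<^esub>\<close> and \<open>\<Sum>\<^sub>j n\<^sub>j \<delta>\<^bsub>y\<^sub>j\<^esub>\<close> give to \<open>v\<close>. As all the points
  are distinct, their difference is \<open>m\<^sub>i\<close> at \<open>v = x\<^sub>i\<close>, \<open>- n\<^sub>j\<close> at \<open>v = y\<^sub>j\<close>, and \<open>0\<close> elsewhere.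
\<close>

definition transport_path ::
  "(real^'m) set \<Rightarrow> ('k::finite \<Rightarrow> real^'m) \<Rightarrow> ('l::finite \<Rightarrow> real^'m) \<Rightarrow>
   ('k \<Rightarrow> real) \<Rightarrow> ('l \<Rightarrow> real) \<Rightarrow> (real^'m) weighted_digraph \<Rightarrow> bool" where
  "transport_path X x y m n = (\<lambda>(G, wt).
     pair_digraph G \<and> pverts G \<subseteq> X \<and> range x \<subseteq> pverts G \<and> range y \<subseteq> pverts G \<and>
     (\<forall>e\<in>parcs G. 0 < wt e) \<and>
     (\<forall>v\<in>pverts G.
        (\<Sum>e | e \<in> parcs G \<and> fst e = v. wt e) =
        (\<Sum>e | e \<in> parcs G \<and> snd e = v. wt e)
          + ((\<Sum>i | x i = v. m i) - (\<Sum>j | y j = v. n j))) \<and>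
     (\<forall>i j. \<exists>\<^sub>\<le>\<^sub>1c. directed_curve G (x i) (y j) c))"

definition compatible ::
  "('k::finite \<Rightarrow> 'v) \<Rightarrow> ('l::finite \<Rightarrow> 'v) \<Rightarrow> 'v weighted_digraph \<Rightarrow> real^'l^'k \<Rightarrow> bool" where
  "compatible x y = (\<lambda>(G, wt) q.
     (\<forall>i j. (\<nexists>c. directed_curve G (x i) (y j) c) \<longrightarrow> q $ i $ j = 0) \<and>
     (\<forall>e\<in>parcs G.
        (\<Sum>(i, j) | \<exists>c. directed_curve G (x i) (y j) c \<and> e \<in> set (vwalk_arcs c). q $ i $ j)
          = wt e))"

definition Omega ::
  "(real^'m) set \<Rightarrow> ('k::finite \<Rightarrow> real^'m) \<Rightarrow> ('l::finite \<Rightarrow> real^'m) \<Rightarrow> real^'l^'k \<Rightarrow>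
   (real^'m) weighted_digraph set" where
  "Omega X x y qbar =
     {G. transport_path X x y (source_mass qbar) (target_mass qbar) G \<and> compatible x y G qbar}"

text \<open>
  Minimum and maximum of a set of reals are written with \<open>LEAST\<close> and \<open>GREATEST\<close>; these
  values are unspecified when the extremum is not attained. The minimum in \<open>min_expenditure p u t\<close>
  is attained for continuous \<open>u\<close>, positive \<open>p\<close> and \<open>t\<close> in the orthant, by compactness; for the
  maximum in \<open>exchange_value\<close>, attainment has to be asserted along with any claim about its value.
\<close>

definition min_expenditure :: "real^'k \<Rightarrow> (real^'k \<Rightarrow> real) \<Rightarrow> real^'k::finite \<Rightarrow> real" where
  "min_expenditure p u t = (LEAST c. c \<in> (\<lambda>s. p \<bullet> s) ` {s \<in> nonneg_orthant. u t \<le> u s})"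

definition total_expenditure ::
  "('l \<Rightarrow> real^'k \<Rightarrow> real) \<Rightarrow> ('l \<Rightarrow> real^'k) \<Rightarrow> real^'l::finite^'k::finite \<Rightarrow> real" where
  "total_expenditure u p q = (\<Sum>j\<in>UNIV. min_expenditure (p j) (u j) (column j q))"

definition feasible_plans ::
  "('k::finite \<Rightarrow> 'v) \<Rightarrow> ('l::finite \<Rightarrow> 'v) \<Rightarrow> ('l \<Rightarrow> real^'k \<Rightarrow> real) \<Rightarrow> real^'l^'k \<Rightarrow>
   'v weighted_digraph \<Rightarrow> (real^'l^'k) set" where
  "feasible_plans x y u qbar G =
     {q \<in> prob_matrices. compatible x y G q \<and> (\<forall>j. u j (column j qbar) \<le> u j (column j q))}"

definition exchange_value ::
  "('k::finite \<Rightarrow> 'v) \<Rightarrow> ('l::finite \<Rightarrow> 'v) \<Rightarrow> ('l \<Rightarrow> real^'k \<Rightarrow> real) \<Rightarrow> ('l \<Rightarrow> real^'k) \<Rightarrow>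
   real^'l^'k \<Rightarrow> 'v weighted_digraph \<Rightarrow> real" where
  "exchange_value x y u p qbar G =
     (GREATEST s. s \<in> total_expenditure u p ` feasible_plans x y u qbar G)
       - total_expenditure u p qbar"

end

theory Submission
  imports Defs
begin

text \<open>
  Splitting the weights of \<open>G\<close> along the curves \<open>g\<^sub>i\<^sub>j\<close> shows that the net outflow of \<open>G\<close> at
  \<open>x\<^sub>i\<close> is the \<open>i\<close>-th row sum of every compatible plan \<open>q\<close>, so a feasible \<open>q\<close> has the row sums of
  \<open>qbar\<close> and costs the same in total at the common price \<open>p\<^sub>1\<close>. As a bundle at least as good as the
  optimal one is at least as expensive, every consumer spends under \<open>q\<close> exactly what he spends under
  \<open>qbar\<close>. Hence his bundle is affordable and has the same utility as the optimal one, and all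
  feasible plans have the same exchange value as \<open>qbar\<close>.
\<close>

text \<open>Every inner vertex of \<open>c\<close> is entered once and left once, so only the two
  ends can contribute.\<close>

lemma sum_vwalk_arcs_telescope:
  fixes c :: "'v list"
  assumes "distinct c" "c \<noteq> []"
  shows "(\<Sum>e\<in>set (vwalk_arcs c). of_bool (fst e = v) - of_bool (snd e = v) :: real)
    = of_bool (hd c = v) - of_bool (last c = v)"
  using assms
proof (induction c rule: vwalk_arcs.induct)
  case (3 a b c)
  \<comment> \<open>The first arc cannot recur, since its tail \<open>a\<close> is not a vertex of
    the rest; so the sum over the set of arcs gains a new term.\<close>
  have "set (vwalk_arcs (b # c)) \<subseteq> set (b # c) \<times> set (b # c)"
    by (induction c arbitrary: b) auto
  then have "(a, b) \<notin> set (vwalk_arcs (b # c))"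
    using 3 by auto
  then show ?case
    using 3 by simp
qed auto

text \<open>The left side does not involve \<open>q\<close>, so all plans compatible with the same
  weighted graph share their row sums.\<close>

lemma compatible_net_outflow:
  fixes x :: "'k::finite \<Rightarrow> 'v" and y :: "'l::finite \<Rightarrow> 'v"
  assumes fin: "finite (parcs G)"
    and unique: "\<And>i j. \<exists>\<^sub>\<le>\<^sub>1c. directed_curve G (x i) (y j) c"
    and comp: "compatible x y (G, wt) q"
    and inj: "inj x" and xy: "\<And>i j. x i \<noteq> y j"
  shows "(\<Sum>e | e \<in> parcs G \<and> fst e = x i. wt e) - (\<Sum>e | e \<in> parcs G \<and> snd e = x i. wt e)
    = source_mass q i"
proof -
  define P where "P = {(i, j). \<exists>c. directed_curve G (x i) (y j) c}"
  \<comment> \<open>Outside \<open>P\<close> the value of \<open>g\<close> is irrelevant: it is only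
    used at pairs joined by a curve.\<close>
  define g where "g = (\<lambda>(i, j). THE c. directed_curve G (x i) (y j) c)"
  define A where "A = (\<lambda>ij. set (vwalk_arcs (g ij)))"
  have g_eq: "g (i, j) = c" if "directed_curve G (x i) (y j) c" for i j c
    using that unique[of i j] unfolding g_def Uniq_def by auto
  have curve: "directed_curve G (x i) (y j) (g (i, j))" if "(i, j) \<in> P" for i j
    using that g_eq unfolding P_def by auto
  have A_sub: "A ij \<subseteq> parcs G" if "ij \<in> P" for ij
    using curve[of "fst ij" "snd ij"] that
    by (auto simp: A_def directed_curve_def vpath_def vwalk_def)
  let ?s = "\<lambda>e. of_bool (fst e = x i) - of_bool (snd e = x i) :: real"
  have wt: "wt e = (\<Sum>ij\<in>P. of_bool (e \<in> A ij) * q $ fst ij $ snd ij)" if "e \<in> parcs G" for e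
  proof -
    have "{(i, j). \<exists>c. directed_curve G (x i) (y j) c \<and> e \<in> set (vwalk_arcs c)}
        = {ij \<in> P. e \<in> A ij}"
      using g_eq curve by (auto simp: P_def A_def)
    then have "wt e = (\<Sum>(i, j) \<in> {ij \<in> P. e \<in> A ij}. q $ i $ j)"
      using comp that by (auto simp: compatible_def)
    also have "\<dots> = (\<Sum>ij\<in>P. of_bool (e \<in> A ij) * q $ fst ij $ snd ij)"
      by (simp add: case_prod_beta Int_def)
    finally show ?thesis .
  qed
  \<comment> \<open>The curve of \<open>ij\<close> starts at \<open>x i\<close> only if
    \<open>fst ij = i\<close>, by injectivity, and it ends at a consumer, hence never at
    \<open>x i\<close>.\<close>
  have path: "(\<Sum>e\<in>A ij. ?s e) = of_bool (fst ij = i)" if "ij \<in> P" for ij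
    using curve[of "fst ij" "snd ij"] that inj xy[of i "snd ij"]
      sum_vwalk_arcs_telescope[of "g ij" "x i"]
    by (auto simp: A_def directed_curve_def vpath_def vwalk_def inj_eq)
  have restrict: "(\<Sum>e | e \<in> parcs G \<and> Q e. wt e) = (\<Sum>e\<in>parcs G. of_bool (Q e) * wt e)" for Q
    using fin by (simp add: Int_def)
  have "(\<Sum>e | e \<in> parcs G \<and> fst e = x i. wt e) - (\<Sum>e | e \<in> parcs G \<and> snd e = x i. wt e)
      = (\<Sum>e\<in>parcs G. ?s e * wt e)"
    by (simp add: restrict left_diff_distrib sum_subtractf)
  also have "\<dots> = (\<Sum>e\<in>parcs G. \<Sum>ij\<in>P. ?s e * (of_bool (e \<in> A ij) * q $ fst ij $ snd ij))"
    by (simp add: wt sum_distrib_left del: sum_of_bool_mult_eq)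
  also have "\<dots> = (\<Sum>ij\<in>P. \<Sum>e\<in>parcs G. ?s e * (of_bool (e \<in> A ij) * q $ fst ij $ snd ij))"
    by (rule sum.swap)
  also have "\<dots> = (\<Sum>ij\<in>P. of_bool (fst ij = i) * q $ fst ij $ snd ij)"
  proof (rule sum.cong[OF refl])
    fix ij assume ij: "ij \<in> P"
    have "(\<Sum>e\<in>parcs G. ?s e * (of_bool (e \<in> A ij) * q $ fst ij $ snd ij))
        = (\<Sum>e\<in>A ij. ?s e * q $ fst ij $ snd ij)"
      using A_sub[OF ij] fin by (intro sum.mono_neutral_cong_right) auto
    also have "\<dots> = of_bool (fst ij = i) * q $ fst ij $ snd ij"
      by (simp only: path[OF ij] flip: sum_distrib_right)
    finally show "(\<Sum>e\<in>parcs G. ?s e * (of_bool (e \<in> A ij) * q $ fst ij $ snd ij))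
        = of_bool (fst ij = i) * q $ fst ij $ snd ij" .
  qed
  \<comment> \<open>Pairs of \<open>P\<close> in other rows are removed by the indicator; pairs of
    row \<open>i\<close> outside \<open>P\<close> carry no mass, by compatibility.\<close>
  also have "\<dots> = (\<Sum>ij\<in>Pair i ` UNIV. q $ fst ij $ snd ij)"
    using comp by (intro sum.mono_neutral_cong) (auto simp: P_def compatible_def)
  also have "\<dots> = source_mass q i"
    by (simp add: source_mass_def sum.reindex inj_on_def)
  finally show ?thesis .
qed

text \<open>With one price vector for all consumers, total cost can be grouped by goods and sees
  only the row sums.\<close>

lemma sum_inner_column:
  fixes a :: "real^'k::finite" and q :: "real^'l::finite^'k"
  shows "(\<Sum>j\<in>UNIV. a \<bullet> column j q) = (\<Sum>i\<in>UNIV. a $ i * source_mass q i)"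
  unfolding inner_vec_def column_def source_mass_def
  by (simp add: sum_distrib_left) (rule sum.swap)

context exchange_economy
begin

text \<open>Money left over would buy some more of every good, giving an affordable bundle strictly
  better than the optimal one.\<close>

lemma expenditure_ge_wealth:
  assumes t: "t \<in> nonneg_orthant" and better: "u j (column j qbar) \<le> u j t"
  shows "w j \<le> p j \<bullet> t"
proof (rule ccontr)
  assume "\<not> ?thesis"
  then have gap: "0 < w j - p j \<bullet> t" by simp
  \<comment> \<open>\<open>r\<close> is the price of one unit of each good, so \<open>s\<close>
    spends the leftover on equal amounts of all goods and costs exactly \<open>w j\<close>.\<close>
  define r where "r = (\<Sum>i\<in>UNIV. p j $ i)"
  have r: "0 < r"
    unfolding r_def by (intro sum_pos) (auto simp: price_pos)
  define s where "s = t + ((w j - p j \<bullet> t) / r) *\<^sub>R 1"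
  have s_nth: "s $ i = t $ i + (w j - p j \<bullet> t) / r" for i
    by (simp add: s_def)
  have less: "t $ i < s $ i" for i
    using gap r by (simp add: s_nth)
  have s: "s \<in> nonneg_orthant"
    using t less by (force simp: nonneg_orthant_def intro: order_trans[OF _ less_imp_le])
  have "p j \<bullet> 1 = r"
    by (simp add: inner_vec_def r_def)
  then have "p j \<bullet> s = w j"
    using r by (simp add: s_def inner_add_right)
  then have "\<not> u j (column j qbar) < u j s"
    using s qbar_optimal[of j] by (auto simp: is_arg_max_def budget_set_def)
  then show False
    using u_increasing[OF t s, of j] less better by simp
qed

lemma column_qbar_in_budget_set: "column j qbar \<in> budget_set (p j) (w j)"
  using qbar_optimal[of j] by (simp add: is_arg_max_def)

lemma qbar_in_prob_matrices: "qbar \<in> prob_matrices"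
  using column_qbar_in_budget_set qbar_normalized
  by (auto simp: prob_matrices_def budget_set_def nonneg_orthant_def column_def)

lemma utility_eq_if_same_source_mass:
  assumes q: "\<And>j. column j q \<in> nonneg_orthant"
    and mass: "\<And>i. source_mass q i = source_mass qbar i"
    and better: "\<And>j. u j (column j qbar) \<le> u j (column j q)"
    and prices: "\<And>j. \<exists>c>0. p j = c *\<^sub>R a"
  shows "u j (column j q) = u j (column j qbar)"
proof -
  \<comment> \<open>At prices \<open>p j\<close> the wealth \<open>w j\<close> separates the two
    costs; dividing by \<open>c > 0\<close> passes to the common price \<open>a\<close>.\<close>
  have le: "a \<bullet> column j qbar \<le> a \<bullet> column j q" for j
  proof -
    obtain c where "c > 0" "p j = c *\<^sub>R a"
      using prices by blast
    moreover have "p j \<bullet> column j qbar \<le> p j \<bullet> column j q"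
      using column_qbar_in_budget_set[of j] expenditure_ge_wealth[OF q better, of j]
      by (simp add: budget_set_def)
    ultimately show ?thesis by simp
  qed
  have "(\<Sum>j\<in>UNIV. a \<bullet> column j qbar) = (\<Sum>j\<in>UNIV. a \<bullet> column j q)"
    by (simp add: sum_inner_column mass)
  \<comment> \<open>Termwise inequalities between equal sums are equalities.\<close>
  then have "a \<bullet> column j qbar = a \<bullet> column j q"
    using sum_mono_inv[of "\<lambda>j. a \<bullet> column j qbar" UNIV "\<lambda>j. a \<bullet> column j q"] le by simp
  then have "p j \<bullet> column j q = p j \<bullet> column j qbar"
    using prices[of j] by auto
  then have "column j q \<in> budget_set (p j) (w j)"
    using q column_qbar_in_budget_set[of j] by (simp add: budget_set_def)
  then have "\<not> u j (column j qbar) < u j (column j q)"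
    using qbar_optimal[of j] by (auto simp: is_arg_max_def)
  then show ?thesis
    using better[of j] by simp
qed

end

theorem proposition3p8:
  fixes X :: "(real^'m) set"
    and x :: "'k::finite \<Rightarrow> real^'m"
    and y :: "'l::finite \<Rightarrow> real^'m"
    and u :: "'l \<Rightarrow> real^'k \<Rightarrow> real"
    and p :: "'l \<Rightarrow> real^'k"
    and w :: "'l \<Rightarrow> real"
    and qbar :: "real^'l^'k"
    and j1 :: 'l
    and G :: "(real^'m) weighted_digraph"
  assumes "exchange_economy X x y u p w qbar"
    and collinear_prices: "\<forall>j. \<exists>c>0. p j = c *\<^sub>R p j1"
    and "G \<in> Omega X x y qbar"
  shows "(\<exists>q. is_arg_max (total_expenditure u p) (\<lambda>q. q \<in> feasible_plans x y u qbar G) q)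
    \<and> exchange_value x y u p qbar G = 0"
proof -
  interpret exchange_economy X x y u p w qbar by fact
  obtain H wt where G: "G = (H, wt)" by fastforce
  have comp: "compatible x y (H, wt) qbar"
    and graph: "pair_digraph H"
    and unique: "\<And>i j. \<exists>\<^sub>\<le>\<^sub>1c. directed_curve H (x i) (y j) c"
    using assms(3) by (auto simp: G Omega_def transport_path_def)
  have fin: "finite (parcs H)"
    using graph by (simp add: pair_digraph.axioms pair_fin_digraph.pair_finite_arcs)
  let ?F = "feasible_plans x y u qbar G"
  have qbar_feasible: "qbar \<in> ?F"
    using comp qbar_in_prob_matrices by (simp add: feasible_plans_def G)
  have const: "total_expenditure u p q = total_expenditure u p qbar" if "q \<in> ?F" for q
  proof -
    have q: "q \<in> prob_matrices" "compatible x y (H, wt) q"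
      "\<And>j. u j (column j qbar) \<le> u j (column j q)"
      using that by (auto simp: feasible_plans_def G)
    have "source_mass q i = source_mass qbar i" for i
      using compatible_net_outflow[OF fin unique q(2) inj_x x_neq_y, of i]
        compatible_net_outflow[OF fin unique comp inj_x x_neq_y, of i] by simp
    moreover have "column j q \<in> nonneg_orthant" for j
      using q(1) by (simp add: prob_matrices_def nonneg_orthant_def column_def)
    ultimately have "u j (column j q) = u j (column j qbar)" for j
      using q(3) collinear_prices by (intro utility_eq_if_same_source_mass) auto
    \<comment> \<open>\<open>min_expenditure\<close> depends on a bundle only through its
      utility.\<close>
    then show ?thesis
      by (simp add: total_expenditure_def min_expenditure_def)
  qed
  then have "total_expenditure u p ` ?F = (\<lambda>_. total_expenditure u p qbar) ` ?F"
    by (intro image_cong refl)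
  \<comment> \<open>Feasibility of \<open>qbar\<close> makes the image nonempty, so the
    \<open>GREATEST\<close> is attained.\<close>
  also have "\<dots> = {total_expenditure u p qbar}"
    using qbar_feasible by auto
  finally have "exchange_value x y u p qbar G = 0"
    by (auto simp: exchange_value_def intro: Greatest_equality)
  moreover have "is_arg_max (total_expenditure u p) (\<lambda>q. q \<in> ?F) qbar"
    using const qbar_feasible unfolding is_arg_max_def by (metis less_irrefl)
  ultimately show ?thesis by blast
qed

end
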